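(* Let $f=[f^L,f^U]\colon\mathbb{R}^n\to\mathcal{K}_c$ be an interval-valued function and let the constraint set $X=\{x\in\mathbb{R}^n : g_j(x)\le 0,\ j=1,\dots,m\}$, with $g_j\colon\mathbb{R}^n\to\mathbb{R}$, be nonempty and closed. Assume that $f$ is $LU$-bounded from below on $X$ by an interval $B\in\mathcal{K}_c$. Then, for each $\mathcal{E}=[\epsilon^L,\epsilon^U]\in\mathcal{K}_c$ satisfying $0\prec_{LU}\mathcal{E}$, the problem of minimizing $f$ over $X$ admits at least one $\mathcal{E}$-$LU$-solution.
   Context: $\mathcal{K}_c$ is the set of all closed bounded intervals $[a^L,a^U]\subset\mathbb{R}$, $a^L\le a^U$; $0$ denotes the interval $[0,0]$. An interval-valued function is $f(x)=[f^L(x),f^U(x)]$ with $f^L,f^U\colon\mathbb{R}^n\to\mathbb{R}$ and $f^L(x)\le f^U(x)$ for all $x$. Interval subtraction: $[a^L,a^U]-[b^L,b^U]=[a^L-b^U,\,a^U-b^L]$. Order: $[a^L,a^U]\preceq_{LU}[b^L,b^U]$ iff $a^L\le b^L$ and $a^U\le b^U$; $A\prec_{LU}B$ iff $A\preceq_{LU}B$ and $A\ne B$. $f$ is $LU$-bounded from below on $X$ by $B\in\mathcal{K}_c$ if $B\preceq_{LU}f(x)$ for all $x\in X$. A point $x^*\in X$ is an $\mathcal{E}$-$LU$-solution if there is no $x\in X$ with $f(x)\prec_{LU}f(x^* )-\mathcal{E}$. *)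

theory Defs
  imports "HOL-Analysis.Analysis" "HOL-Library.Interval"
begin

text \<open>
  Closed bounded intervals are the library type \<open>real interval\<close>. Its \<open>0\<close> is the interval with
  both endpoints \<open>0\<close>, and its subtraction has lower endpoint \<open>lower A - upper B\<close> and upper
  endpoint \<open>upper A - lower B\<close>. Its \<open>\<le>\<close> and \<open><\<close> are inclusion of intervals and are not
  used here; the LU order compares endpoints instead.
\<close>

definition LU_le :: "real interval \<Rightarrow> real interval \<Rightarrow> bool" (infix "\<preceq>\<^sub>L\<^sub>U" 50)
  where "A \<preceq>\<^sub>L\<^sub>U B \<longleftrightarrow> lower A \<le> lower B \<and> upper A \<le> upper B"

definition LU_less :: "real interval \<Rightarrow> real interval \<Rightarrow> bool" (infix "\<prec>\<^sub>L\<^sub>U" 50)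
  where "A \<prec>\<^sub>L\<^sub>U B \<longleftrightarrow> A \<preceq>\<^sub>L\<^sub>U B \<and> A \<noteq> B"

definition LU_bounded_below_by :: "('a \<Rightarrow> real interval) \<Rightarrow> 'a set \<Rightarrow> real interval \<Rightarrow> bool"
  where "LU_bounded_below_by f X B \<longleftrightarrow> (\<forall>x\<in>X. B \<preceq>\<^sub>L\<^sub>U f x)"

definition feasible_set :: "nat \<Rightarrow> (nat \<Rightarrow> 'a \<Rightarrow> real) \<Rightarrow> 'a set"
  where "feasible_set m g = {x. \<forall>j\<in>{1..m}. g j x \<le> 0}"

definition E_LU_solution ::
    "('a \<Rightarrow> real interval) \<Rightarrow> 'a set \<Rightarrow> real interval \<Rightarrow> 'a \<Rightarrow> bool"
  where "E_LU_solution f X E x' \<longleftrightarrow> x' \<in> X \<and> \<not> (\<exists>x\<in>X. f x \<prec>\<^sub>L\<^sub>U f x' - E)"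

end

theory Submission
  imports Defs
begin

text \<open>
  Subtracting \<open>E\<close> lowers the lower endpoint by \<open>upper E\<close>, and \<open>0 \<prec>\<^sub>L\<^sub>U E\<close> forces
  \<open>upper E > 0\<close> even when \<open>lower E = 0\<close>. So a point whose lower endpoint is within
  \<open>upper E\<close> of its infimum over \<open>X\<close> is an \<open>E\<close>-solution.
\<close>

lemma LU_less_zero_imp_upper_pos:
  assumes "0 \<prec>\<^sub>L\<^sub>U E"
  shows "upper E > 0"
proof (rule ccontr)
  assume "\<not> upper E > 0"
  \<comment> \<open>The endpoints are squeezed: 0 \<le> \<open>lower E\<close> \<le>
    \<open>upper E\<close> \<le> 0.\<close>
  with assms lower_le_upper[of E] have "lower E = 0" "upper E = 0"
    by (auto simp: LU_less_def LU_le_def)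
  then have "E = 0"
    by (simp add: interval_eq_iff)
  with assms show False
    by (simp add: LU_less_def)
qed

lemma ex_E_LU_solution:
  assumes "X \<noteq> {}" and bdd: "LU_bounded_below_by f X B" and E: "0 \<prec>\<^sub>L\<^sub>U E"
  shows "\<exists>x. E_LU_solution f X E x"
proof -
  define l where "l = (INF x\<in>X. lower (f x))"
  have bb: "bdd_below ((\<lambda>x. lower (f x)) ` X)"
    using bdd by (auto simp: LU_bounded_below_by_def LU_le_def intro: bdd_belowI2)
  \<comment> \<open>The infimum \<open>l\<close> need not be attained, but any number strictly above
    it exceeds \<open>lower (f x')\<close> for some \<open>x'\<close> in \<open>X\<close>.\<close>
  have "l < l + upper E"
    using LU_less_zero_imp_upper_pos[OF E] by simp
  then obtain x' where x': "x' \<in> X" "lower (f x') < l + upper E"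
    unfolding l_def by (subst (asm) cINF_less_iff[OF \<open>X \<noteq> {}\<close> bb]) blast
  have "\<not> f x \<prec>\<^sub>L\<^sub>U f x' - E" if "x \<in> X" for x
  proof -
    have "l \<le> lower (f x)"
      unfolding l_def using bb that by (rule cINF_lower)
    \<comment> \<open>Otherwise the lower endpoints alone would give \<open>lower (f x)\<close>
      \<le> \<open>lower (f x') - upper E\<close> < \<open>l\<close>, below the infimum.\<close>
    with x' show ?thesis
      by (auto simp: LU_less_def LU_le_def)
  qed
  with x' show ?thesis
    by (auto simp: E_LU_solution_def)
qed

theorem theorem3p1:
  fixes f :: "real ^ 'n \<Rightarrow> real interval"
    and m :: nat
    and g :: "nat \<Rightarrow> real ^ 'n \<Rightarrow> real"
    and X :: "(real ^ 'n) set"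
    and B :: "real interval"
  assumes X_def: "X = feasible_set m g"
    and "X \<noteq> {}"
    and "closed X"
    and "LU_bounded_below_by f X B"
  shows "\<forall>E :: real interval. 0 \<prec>\<^sub>L\<^sub>U E \<longrightarrow> (\<exists>x. E_LU_solution f X E x)"
  using ex_E_LU_solution[OF assms(2,4)] by blast

end
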